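(* Let $\lambda_c>0$ and let $s^{(i)}\in\mathbb R^n$ satisfy $\lambda_{\min}[H_i]\ge\lambda_c$. Fix $q\in[0,3)$ and $\tau$ such that $$\tfrac13<\tau<\min\Big\{\tfrac{1}{2(1-q/3)},\,1\Big\},$$ and let $$M_{\alpha^\pm}(s^{(i)},s)=f_i+g_i^Ts+\tfrac12\Big(1\pm\tfrac{1}{3\tau}\Big)s^TH_is+\Big[1\pm2\big(1-\tfrac q3\big)\tau\Big]\tfrac{\sigma}{4}\|s\|^4 .$$ Then: 1) $M_{\alpha^\pm}(s^{(i)},s)$ are convex functions for all $s\in\mathbb R^n$. 2) $M_{\alpha^-}(s^{(i)},s)\le M(s^{(i)},s)\le M_{\alpha^+}(s^{(i)},s)$ for all $s\in\mathcal D^{(i)}(q)$, with equality if and only if $s=0$.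
   Context: Let $f_0\in\mathbb R$, $g\in\mathbb R^n$, $H\in\mathbb R^{n\times n}$ symmetric, $T\in\mathbb R^{n\times n\times n}$ a symmetric third-order tensor, $\sigma>0$, $\|\cdot\|$ the Euclidean norm, and $m_3(s)=f_0+g^Ts+\frac12s^THs+\frac16T[s]^3+\frac{\sigma}{4}\|s\|^4$ for $s\in\mathbb R^n$. For a point $s^{(i)}$: $f_i=m_3(s^{(i)})$, $g_i=\nabla m_3(s^{(i)})$, $H_i=\nabla^2m_3(s^{(i)})$, and $M(s^{(i)},s)=m_3(s^{(i)}+s)$. $\lambda_{\min}[\cdot]$ is the smallest eigenvalue. For $q\ge0$, $\mathcal D^{(i)}(q)\subseteq\mathbb R^n$ is a region around $s^{(i)}$ (expressed in terms of the displacement $s$) such that for $s\in\mathcal D^{(i)}(q)$ the following conditions are satisfied: (1) $s^T\nabla^2m_3(s^{(i)}+s)s\ge q\|s\|^4$ and $s^T\nabla^2m_3(s^{(i)}-s)s\ge q\|s\|^4$; (2) for any $s\in\mathcal D^{(i)}(q)$, also $\tau s\in\mathcal D^{(i)}(q)$.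
   Formalization: In part 2 the region is D(σq), i.e. condition (1) reads ≥ σq‖s‖^4, because the bounds for D(q) fail when σ>1 and q>0; "equality" means M_{α-}=M=M_{α+} throughout, since a single inequality can be an equality at some s≠0. *)

theory Defs
  imports "HOL-Analysis.Analysis"
begin

definition grad :: "(real^'n \<Rightarrow> real) \<Rightarrow> real^'n \<Rightarrow> real^'n" where
  "grad f x = (THE D. GDERIV f x :> D)"

definition hess :: "(real^'n \<Rightarrow> real) \<Rightarrow> real^'n \<Rightarrow> real^'n^'n" where
  "hess f x = jacobian (grad f) (at x)"

definition eigenvalue :: "real^'n^'n \<Rightarrow> real \<Rightarrow> bool" where
  "eigenvalue A k \<longleftrightarrow> (\<exists>v. v \<noteq> 0 \<and> A *v v = k *\<^sub>R v)"

text \<open>Meaningful for matrices having a smallest real eigenvalue, in particular for all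
  symmetric ones; the Hessians to which it is applied are symmetric.\<close>

definition lambda_min :: "real^'n^'n \<Rightarrow> real" where
  "lambda_min A = (LEAST k. eigenvalue A k)"

text \<open>The two transpositions generate all permutations of the three indices.\<close>

definition symmetric_tensor :: "real^'n^'n^'n \<Rightarrow> bool" where
  "symmetric_tensor T \<longleftrightarrow>
     (\<forall>i j k. T $ i $ j $ k = T $ j $ i $ k \<and> T $ i $ j $ k = T $ i $ k $ j)"

definition cubic_form :: "real^'n^'n^'n \<Rightarrow> real^'n \<Rightarrow> real" where
  "cubic_form T s = (\<Sum>i\<in>UNIV. \<Sum>j\<in>UNIV. \<Sum>k\<in>UNIV. T $ i $ j $ k * s $ i * s $ j * s $ k)"

definition m3 :: "real \<Rightarrow> real^'n \<Rightarrow> real^'n^'n \<Rightarrow> real^'n^'n^'n \<Rightarrow> real \<Rightarrow> real^'n \<Rightarrow> real" where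
  "m3 f0 g H T \<sigma> s =
     f0 + g \<bullet> s + 1/2 * (s \<bullet> (H *v s)) + 1/6 * cubic_form T s + \<sigma>/4 * norm s ^ 4"

text \<open>\<open>is_region m x \<tau> q D\<close>: the set \<open>D\<close> of displacements from \<open>x\<close> is a region
  \<open>\<D>(q)\<close> for the function \<open>m\<close> and the scaling factor \<open>\<tau>\<close>. The region is not unique, so
  this is a predicate on \<open>D\<close>; no topological condition is imposed on \<open>D\<close>.
  Pitfall: \<open>norm s ^ 4\<close> carries no factor \<open>\<sigma>\<close> here, whereas the coefficients of \<open>M_alpha\<close>
  below measure \<open>q\<close> relative to \<open>\<sigma>\<close>. The two-sided bound for \<open>M_alpha\<close> with parameter \<open>q\<close> needs
  a region with parameter \<open>\<sigma> * q\<close>; with parameter \<open>q\<close> it fails when \<open>\<sigma> > 1\<close> and \<open>q > 0\<close>, e.g. for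
  \<open>1 + s\<^sup>2 / 2 - 43 / 60 * s ^ 3 + s ^ 4 / 2\<close> in dimension one, with \<open>x = 0\<close>, \<open>\<sigma> = 2\<close>, \<open>q = 1\<close>,
  \<open>\<tau> = 1/2\<close>, \<open>D = UNIV\<close>, at \<open>s = 1\<close>.\<close>

definition is_region ::
  "(real^'n \<Rightarrow> real) \<Rightarrow> real^'n \<Rightarrow> real \<Rightarrow> real \<Rightarrow> (real^'n) set \<Rightarrow> bool" where
  "is_region m x \<tau> q D \<longleftrightarrow>
     (\<forall>s\<in>D. s \<bullet> (hess m (x + s) *v s) \<ge> q * norm s ^ 4 \<and>
             s \<bullet> (hess m (x - s) *v s) \<ge> q * norm s ^ 4) \<and>
     (\<forall>s\<in>D. \<tau> *\<^sub>R s \<in> D)"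

text \<open>The sign \<open>\<epsilon>\<close> is \<open>1\<close> for the upper model and \<open>-1\<close> for the lower one.\<close>

definition M_alpha ::
  "real \<Rightarrow> (real^'n \<Rightarrow> real) \<Rightarrow> real \<Rightarrow> real \<Rightarrow> real \<Rightarrow> real^'n \<Rightarrow> real^'n \<Rightarrow> real" where
  "M_alpha \<epsilon> m \<sigma> q \<tau> x s =
     m x + grad m x \<bullet> s + 1/2 * (1 + \<epsilon> * (1 / (3 * \<tau>))) * (s \<bullet> (hess m x *v s))
       + (1 + \<epsilon> * (2 * (1 - q/3) * \<tau>)) * (\<sigma>/4) * norm s ^ 4"

abbreviation "M_alpha_plus \<equiv> M_alpha 1"
abbreviation "M_alpha_minus \<equiv> M_alpha (- 1)"

end

(* Along a fixed direction s, with h = s . (hess m x) s and t the third-order term of the expansion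
   at x, the second derivative of r \<mapsto> m (x + r s) is h + r t + 3 \<sigma> r^2 |s|^4. The defining
   inequalities of the region at \<tau> s (not at s) therefore bound |t| by
   h / \<tau> + (3 - q) \<sigma> \<tau> |s|^4, and six times the gap between the models and the first, second
   and fourth order part of m (x + s) is exactly this bound. Equality on both sides makes h vanish,
   which positive definiteness excludes unless s = 0. *)
theory Submission
  imports Defs
begin

section \<open>Third-order tensors as bilinear maps\<close>

text \<open>The last index stays free, so that derivatives of the cubic form are vectors and the
  product rule for bounded bilinear maps applies.\<close>

definition tensor_app :: "real^'n^'n^'n \<Rightarrow> real^'n \<Rightarrow> real^'n \<Rightarrow> real^'n" where
  "tensor_app T y z = (\<chi> k. \<Sum>i\<in>UNIV. \<Sum>j\<in>UNIV. T $ i $ j $ k * y $ i * z $ j)"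

lemma bounded_bilinear_tensor_app: "bounded_bilinear (tensor_app T)"
  unfolding bilinear_conv_bounded_bilinear[symmetric] bilinear_def
  by (auto intro!: linearI
      simp: tensor_app_def vec_eq_iff algebra_simps sum.distrib sum_distrib_left)

lemma cubic_form_eq_tensor_app: "cubic_form T s = tensor_app T s s \<bullet> s"
proof -
  have "tensor_app T s s \<bullet> s =
      (\<Sum>k\<in>UNIV. \<Sum>i\<in>UNIV. \<Sum>j\<in>UNIV. T $ i $ j $ k * s $ i * s $ j * s $ k)"
    by (simp add: tensor_app_def inner_vec_def sum_distrib_right)
  also have "\<dots> = (\<Sum>i\<in>UNIV. \<Sum>k\<in>UNIV. \<Sum>j\<in>UNIV. T $ i $ j $ k * s $ i * s $ j * s $ k)"
    by (rule sum.swap)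
  also have "\<dots> = cubic_form T s"
    unfolding cubic_form_def by (intro sum.cong refl sum.swap)
  finally show ?thesis by simp
qed

lemma tensor_app_commute:
  assumes "symmetric_tensor T"
  shows "tensor_app T y z = tensor_app T z y"
proof -
  have "T $ i $ j $ k = T $ j $ i $ k" for i j k
    using assms by (auto simp: symmetric_tensor_def)
  then show ?thesis
    unfolding tensor_app_def vec_eq_iff vec_lambda_beta
    by (subst sum.swap) (simp add: mult_ac)
qed

text \<open>Together with \<open>tensor_app_commute\<close> this makes the trilinear form invariant
  under all permutations of its arguments, which merges the mixed terms in the derivatives and in
  the expansion.\<close>

lemma inner_tensor_app_commute:
  assumes "symmetric_tensor T"
  shows "tensor_app T y z \<bullet> w = tensor_app T y w \<bullet> z"
proof -
  have sym: "T $ i $ j $ k = T $ i $ k $ j" for i j k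
    using assms by (auto simp: symmetric_tensor_def)
  have ex: "tensor_app T y z \<bullet> w =
      (\<Sum>i\<in>UNIV. \<Sum>j\<in>UNIV. \<Sum>k\<in>UNIV. T $ i $ j $ k * y $ i * z $ j * w $ k)" for z w
  proof -
    have "tensor_app T y z \<bullet> w =
        (\<Sum>k\<in>UNIV. \<Sum>i\<in>UNIV. \<Sum>j\<in>UNIV. T $ i $ j $ k * y $ i * z $ j * w $ k)"
      by (simp add: tensor_app_def inner_vec_def sum_distrib_right)
    also have "\<dots> = (\<Sum>i\<in>UNIV. \<Sum>k\<in>UNIV. \<Sum>j\<in>UNIV. T $ i $ j $ k * y $ i * z $ j * w $ k)"
      by (rule sum.swap)
    also have "\<dots> = (\<Sum>i\<in>UNIV. \<Sum>j\<in>UNIV. \<Sum>k\<in>UNIV. T $ i $ j $ k * y $ i * z $ j * w $ k)"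
      by (intro sum.cong refl sum.swap)
    finally show ?thesis .
  qed
  have "tensor_app T y z \<bullet> w =
      (\<Sum>i\<in>UNIV. \<Sum>k\<in>UNIV. \<Sum>j\<in>UNIV. T $ i $ j $ k * y $ i * z $ j * w $ k)"
    unfolding ex by (intro sum.cong refl sum.swap)
  also have "\<dots> = tensor_app T y w \<bullet> z"
    unfolding ex by (intro sum.cong refl, subst sym) (simp add: mult_ac)
  finally show ?thesis .
qed

section \<open>Gradient and Hessian of the quartic model\<close>

lemma inner_symmetric_matrix:
  fixes A :: "real^'n^'n"
  assumes "transpose A = A"
  shows "a \<bullet> (A *v b) = b \<bullet> (A *v a)"
  by (metis assms dot_lmul_matrix inner_commute transpose_matrix_vector)

text \<open>A polynomial in the inner product can be differentiated everywhere by the product rule,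
  including at 0, where the norm itself is not differentiable.\<close>

lemma norm_power4: "norm (y::'a::real_inner) ^ 4 = (y \<bullet> y)\<^sup>2"
  by (metis dot_square_norm mult_2 numeral_Bit0 power_add power2_eq_square)

lemma grad_eqI:
  assumes "(f has_derivative (\<lambda>h. h \<bullet> D)) (at x)"
  shows "grad f x = D"
proof -
  have "GDERIV f x :> D" using assms by (simp add: gderiv_def)
  moreover have "D' = D" if "GDERIV f x :> D'" for D'
  proof -
    have "(\<lambda>h. h \<bullet> D') = (\<lambda>h. h \<bullet> D)"
      using that assms unfolding gderiv_def by (rule has_derivative_unique)
    then show ?thesis by (metis inner_commute vector_eq_ldot)
  qed
  ultimately show ?thesis unfolding grad_def by blast
qed

lemma m3_eq_inner:
  "m3 f0 g H T \<sigma> s =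
     f0 + g \<bullet> s + 1/2 * (s \<bullet> (H *v s)) + 1/6 * (tensor_app T s s \<bullet> s) + \<sigma>/4 * (s \<bullet> s)\<^sup>2"
  by (simp add: m3_def cubic_form_eq_tensor_app norm_power4)

lemma grad_m3:
  assumes H: "transpose H = H" and T: "symmetric_tensor T"
  shows "grad (m3 f0 g H T \<sigma>) y =
    g + H *v y + (1/2) *\<^sub>R tensor_app T y y + (\<sigma> * (y \<bullet> y)) *\<^sub>R y"
proof (rule grad_eqI)
  interpret t: bounded_bilinear "tensor_app T" by (rule bounded_bilinear_tensor_app)
  \<comment> \<open>The product rule yields three contractions of \<open>T\<close> with
    \<open>y\<close>, \<open>y\<close>, \<open>h\<close>; by symmetry they agree, so the factor 1/6
    becomes 1/2.\<close>
  have c: "y \<bullet> tensor_app T h y = h \<bullet> tensor_app T y y"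
    "y \<bullet> tensor_app T y h = h \<bullet> tensor_app T y y" for h
    using tensor_app_commute[OF T] inner_tensor_app_commute[OF T] by (metis inner_commute)+
  show "(m3 f0 g H T \<sigma> has_derivative
     (\<lambda>h. h \<bullet> (g + H *v y + (1/2) *\<^sub>R tensor_app T y y + (\<sigma> * (y \<bullet> y)) *\<^sub>R y))) (at y)"
    unfolding m3_eq_inner[abs_def]
    apply (rule has_derivative_eq_rhs)
     apply (rule derivative_intros t.FDERIV bounded_linear.has_derivative[OF matrix_vector_mul_bounded_linear] | simp)+
    apply (rule ext)
    subgoal for h
      using inner_symmetric_matrix[OF H, of y h]
      by (simp add: c inner_commute algebra_simps power2_eq_square)
    done
qed

text \<open>Differentiating the gradient: the two halves of the tensor term merge by symmetry, and
  the factor \<open>y \<bullet> y\<close> contributes the rank-one term. Giving the action on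
  \<open>h\<close> avoids matrix entries.\<close>

lemma hess_m3:
  assumes H: "transpose H = H" and T: "symmetric_tensor T"
  shows "hess (m3 f0 g H T \<sigma>) y *v h =
    H *v h + tensor_app T y h + \<sigma> *\<^sub>R ((y \<bullet> y) *\<^sub>R h + (2 * (y \<bullet> h)) *\<^sub>R y)"
proof -
  interpret t: bounded_bilinear "tensor_app T" by (rule bounded_bilinear_tensor_app)
  define L where "L h = H *v h + tensor_app T y h + \<sigma> *\<^sub>R ((y \<bullet> y) *\<^sub>R h + (2 * (y \<bullet> h)) *\<^sub>R y)" for h
  have G: "grad (m3 f0 g H T \<sigma>) =
      (\<lambda>y. g + H *v y + (1/2) *\<^sub>R tensor_app T y y + (\<sigma> * (y \<bullet> y)) *\<^sub>R y)"
    using grad_m3[OF H T] by (rule ext)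
  have D: "(grad (m3 f0 g H T \<sigma>) has_derivative L) (at y)"
    unfolding G
    apply (rule has_derivative_eq_rhs)
     apply (rule derivative_intros t.FDERIV bounded_linear.has_derivative[OF matrix_vector_mul_bounded_linear] | simp)+
    apply (rule ext)
    subgoal for h
      by (simp add: L_def tensor_app_commute[OF T, of h y] inner_commute[of h y]
          vec_eq_iff algebra_simps)
    done
  have "hess (m3 f0 g H T \<sigma>) y *v h = L h"
    unfolding hess_def jacobian_def frechet_derivative_at[OF D, symmetric]
    using has_derivative_linear[OF D] by (metis matrix_vector_mul(2))
  then show ?thesis by (simp add: L_def)
qed

lemma inner_hess_m3_symmetric:
  assumes H: "transpose H = H" and T: "symmetric_tensor T"
  shows "a \<bullet> (hess (m3 f0 g H T \<sigma>) y *v b) = b \<bullet> (hess (m3 f0 g H T \<sigma>) y *v a)"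
  using inner_symmetric_matrix[OF H, of a b] inner_tensor_app_commute[OF T, of y a b]
  by (simp add: hess_m3[OF H T] algebra_simps inner_commute)

section \<open>Exact expansion along a direction\<close>

text \<open>A quartic polynomial has no remainder. The bracket after 1/6 is the third derivative at
  \<open>x\<close> along \<open>s\<close>; its second summand comes from the cubic part of |x +
  s|^4.\<close>

lemma m3_taylor:
  assumes H: "transpose H = H" and T: "symmetric_tensor T"
    and m_def: "m = m3 f0 g H T \<sigma>"
  shows "m (x + s) = m x + grad m x \<bullet> s + 1/2 * (s \<bullet> (hess m x *v s))
      + 1/6 * (tensor_app T s s \<bullet> s + 6 * \<sigma> * (x \<bullet> s) * (s \<bullet> s)) + \<sigma>/4 * norm s ^ 4"
proof -
  interpret t: bounded_bilinear "tensor_app T" by (rule bounded_bilinear_tensor_app)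
  have c: "tensor_app T s x \<bullet> x = tensor_app T x x \<bullet> s" "tensor_app T x s \<bullet> x = tensor_app T x x \<bullet> s"
    "tensor_app T s x \<bullet> s = tensor_app T x s \<bullet> s" "tensor_app T s s \<bullet> x = tensor_app T x s \<bullet> s"
    using tensor_app_commute[OF T] inner_tensor_app_commute[OF T] by metis+
  show ?thesis
    unfolding m_def grad_m3[OF H T] hess_m3[OF H T] norm_power4 m3_eq_inner
    using inner_symmetric_matrix[OF H, of x s]
    by (simp add: t.add_left t.add_right c inner_add_left inner_add_right matrix_vector_right_distrib
        inner_commute[of s x] inner_commute[of s "H *v _"]
        inner_commute[of s "tensor_app T _ _"] power2_eq_square algebra_simps)
qed

text \<open>The same third-order term as in \<open>m3_taylor\<close> is the coefficient of
  \<open>r\<close>, so Hessian bounds at points x + r s control the cubic term of the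
  expansion.\<close>

lemma hess_m3_along:
  assumes H: "transpose H = H" and T: "symmetric_tensor T"
    and m_def: "m = m3 f0 g H T \<sigma>"
  shows "s \<bullet> (hess m (x + r *\<^sub>R s) *v s) = s \<bullet> (hess m x *v s)
      + r * (tensor_app T s s \<bullet> s + 6 * \<sigma> * (x \<bullet> s) * (s \<bullet> s)) + 3 * \<sigma> * r\<^sup>2 * norm s ^ 4"
proof -
  interpret t: bounded_bilinear "tensor_app T" by (rule bounded_bilinear_tensor_app)
  show ?thesis
    unfolding m_def hess_m3[OF H T] norm_power4
    by (simp add: t.add_left t.scaleR_left
        inner_commute[of s x] inner_commute[of s "tensor_app T _ _"]
        inner_add_left inner_add_right power2_eq_square) algebra
qed

section \<open>Smallest eigenvalue and Rayleigh quotient\<close>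

text \<open>By compactness the quadratic form attains its minimum on the unit sphere. The minimiser
  is an eigenvector and no eigenvalue lies below the minimum, so the \<open>LEAST\<close> in
  \<open>lambda_min\<close> is this minimum.\<close>

lemma lambda_min_le_quadratic_form:
  fixes A :: "real^'n^'n"
  assumes sym: "\<And>a b. a \<bullet> (A *v b) = b \<bullet> (A *v a)"
  shows "lambda_min A * (s \<bullet> s) \<le> s \<bullet> (A *v s)"
proof -
  have "continuous_on (sphere 0 1) (\<lambda>v. v \<bullet> (A *v v))"
    by (intro continuous_intros linear_continuous_on) auto
  then have "\<exists>v\<in>sphere 0 1. \<forall>w\<in>sphere 0 1. v \<bullet> (A *v v) \<le> w \<bullet> (A *v w)"
    by (intro continuous_attains_inf) auto
  then obtain v :: "real^'n" where v: "norm v = 1"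
    and vmin: "\<And>w. norm w = 1 \<Longrightarrow> v \<bullet> (A *v v) \<le> w \<bullet> (A *v w)"
    by auto
  define \<mu> where "\<mu> = v \<bullet> (A *v v)"
  have ray: "\<mu> * (w \<bullet> w) \<le> w \<bullet> (A *v w)" for w
  proof (cases "w = 0")
    case False
    have "\<mu> \<le> (w /\<^sub>R norm w) \<bullet> (A *v (w /\<^sub>R norm w))"
      unfolding \<mu>_def using False by (intro vmin) simp
    also have "\<dots> = (w \<bullet> (A *v w)) / (w \<bullet> w)"
      using False by (simp add: matrix_vector_mult_scaleR dot_square_norm power2_eq_square divide_simps)
    finally show ?thesis using False by (simp add: pos_le_divide_eq)
  qed simp
  have vv: "v \<bullet> v = 1" using v by (simp add: dot_square_norm)
  have eig: "A *v v = \<mu> *\<^sub>R v"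
  proof (rule ccontr)
    assume ne: "A *v v \<noteq> \<mu> *\<^sub>R v"
    \<comment> \<open>The residual of the eigenvalue equation: moving from \<open>v\<close> against
      it would push the form below \<mu> times the squared norm.\<close>
    define w where "w = A *v v - \<mu> *\<^sub>R v"
    define c where "c = w \<bullet> (A *v w) - \<mu> * (w \<bullet> w)"
    have ww: "w \<bullet> w > 0" using ne by (simp add: w_def)
    have wAv: "w \<bullet> (A *v v) = w \<bullet> w + \<mu> * (w \<bullet> v)"
      by (subst (2) w_def) (simp add: inner_diff_right)
    have c0: "c \<ge> 0" using ray[of w] by (simp add: c_def)
    \<comment> \<open>This is \<open>ray\<close> at v + r w: the constant terms cancel, and the
      linear one is 2 r |w|^2 by \<open>wAv\<close>.\<close>
    have quad: "0 \<le> 2 * r * (w \<bullet> w) + r\<^sup>2 * c" for r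
      using ray[of "v + r *\<^sub>R w"] sym[of v w] wAv vv
      by (simp add: c_def \<mu>_def[symmetric] inner_add_left inner_add_right matrix_vector_right_distrib
          matrix_vector_mult_scaleR inner_commute[of v w] power2_eq_square algebra_simps)
    \<comment> \<open>A negative step near the minimiser of the parabola; the denominator c + 1
      instead of c covers c = 0.\<close>
    have "0 \<le> (- (w \<bullet> w) / (c + 1)) * (2 * (w \<bullet> w) - (w \<bullet> w) * (c / (c + 1)))"
      using quad[of "- (w \<bullet> w) / (c + 1)"] by (simp add: power2_eq_square algebra_simps)
    moreover have "(w \<bullet> w) * (c / (c + 1)) < 2 * (w \<bullet> w)"
    proof -
      have "c / (c + 1) < 2" using c0 by (simp add: divide_simps)
      then show ?thesis using mult_strict_left_mono[OF _ ww] by (metis mult.commute)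
    qed
    moreover have "- (w \<bullet> w) / (c + 1) < 0" using ww c0 by (simp add: divide_simps)
    ultimately show False by (smt (verit) mult_neg_pos)
  qed
  have "lambda_min A = \<mu>"
    unfolding lambda_min_def
  proof (rule Least_equality)
    show "eigenvalue A \<mu>" unfolding eigenvalue_def using eig v by (metis norm_zero zero_neq_one)
    fix k assume "eigenvalue A k"
    then obtain w where w: "w \<noteq> 0" "A *v w = k *\<^sub>R w" unfolding eigenvalue_def by blast
    then show "\<mu> \<le> k" using ray[of w] by simp
  qed
  then show ?thesis using ray by simp
qed

section \<open>Convexity of the models\<close>

text \<open>The chord lies above the graph by exactly r (1 - r) times the form at a - b.\<close>

lemma convex_on_quadratic_form:
  fixes A :: "real^'n^'n"
  assumes sym: "\<And>a b. a \<bullet> (A *v b) = b \<bullet> (A *v a)"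
    and psd: "\<And>s. 0 \<le> s \<bullet> (A *v s)"
  shows "convex_on UNIV (\<lambda>s. s \<bullet> (A *v s))"
proof (rule convex_onI)
  fix r :: real and a b :: "real^'n"
  assume r: "0 < r" "r < 1"
  have "0 \<le> r * (1 - r) * ((a - b) \<bullet> (A *v (a - b)))" using r psd by simp
  also have "\<dots> = (1 - r) * (a \<bullet> (A *v a)) + r * (b \<bullet> (A *v b))
      - ((1 - r) *\<^sub>R a + r *\<^sub>R b) \<bullet> (A *v ((1 - r) *\<^sub>R a + r *\<^sub>R b))"
    using sym[of a b]
    by (simp add: matrix_vector_mult_scaleR algebra_simps)
  finally show "((1 - r) *\<^sub>R a + r *\<^sub>R b) \<bullet> (A *v ((1 - r) *\<^sub>R a + r *\<^sub>R b))
      \<le> (1 - r) * (a \<bullet> (A *v a)) + r * (b \<bullet> (A *v b))" by simp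
qed simp

lemma convex_on_norm_power_even:
  assumes "even n"
  shows "convex_on UNIV (\<lambda>s::'a::real_normed_vector. norm s ^ n)"
proof (rule convex_onI)
  fix r :: real and a b :: 'a
  assume r: "0 < r" "r < 1"
  have "norm ((1 - r) *\<^sub>R a + r *\<^sub>R b) ^ n \<le> ((1 - r) * norm a + r * norm b) ^ n"
    using r norm_triangle_ineq[of "(1 - r) *\<^sub>R a" "r *\<^sub>R b"] by (intro power_mono) auto
  also have "\<dots> \<le> (1 - r) * norm a ^ n + r * norm b ^ n"
    using convex_onD[OF convex_power_even[OF assms], of r "norm a" "norm b"] r by simp
  finally show "norm ((1 - r) *\<^sub>R a + r *\<^sub>R b) ^ n \<le> (1 - r) * norm a ^ n + r * norm b ^ n" .
qed simp

text \<open>An affine function plus nonnegative multiples of two convex functions. Keeping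
  \<epsilon> general serves both models; the sign conditions are where the range of \<tau>
  enters.\<close>

lemma convex_on_M_alpha:
  assumes sym: "\<And>a b. a \<bullet> (hess m x *v b) = b \<bullet> (hess m x *v a)"
    and psd: "\<And>s. 0 \<le> s \<bullet> (hess m x *v s)"
    and "0 \<le> 1 + \<epsilon> * (1 / (3 * \<tau>))" and "0 \<le> 1 + \<epsilon> * (2 * (1 - q/3) * \<tau>)" and "0 \<le> \<sigma>"
  shows "convex_on UNIV (M_alpha \<epsilon> m \<sigma> q \<tau> x)"
proof -
  have aff: "convex_on UNIV (\<lambda>s. m x + grad m x \<bullet> s)"
    by (rule convex_onI) (auto simp: inner_add_right algebra_simps)
  show ?thesis
    unfolding M_alpha_def[abs_def]
    using assms(3-5)
    by (intro convex_on_add aff convex_on_cmul convex_on_quadratic_form convex_on_norm_power_even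
        sym psd) auto
qed

section \<open>Convexity and the two-sided bound on the region\<close>

theorem theorem2p2:
  fixes f0 \<sigma> lc q \<tau> :: real
    and g x :: "real^'n"
    and H :: "real^'n^'n"
    and T :: "real^'n^'n^'n"
    and m :: "real^'n \<Rightarrow> real"
  assumes "m = m3 f0 g H T \<sigma>"
    and "transpose H = H"
    and "symmetric_tensor T"
    and "\<sigma> > 0"
    and "lc > 0"
    and "lambda_min (hess m x) \<ge> lc"
    and "0 \<le> q" and "q < 3"
    and "1/3 < \<tau>" and "\<tau> < min (1 / (2 * (1 - q/3))) 1"
  shows "(convex_on UNIV (M_alpha_plus m \<sigma> q \<tau> x) \<and> convex_on UNIV (M_alpha_minus m \<sigma> q \<tau> x)) \<and>
    (\<forall>D. is_region m x \<tau> (\<sigma> * q) D \<longrightarrow> (\<forall>s\<in>D.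
       M_alpha_minus m \<sigma> q \<tau> x s \<le> m (x + s) \<and>
       m (x + s) \<le> M_alpha_plus m \<sigma> q \<tau> x s \<and>
       (M_alpha_minus m \<sigma> q \<tau> x s = m (x + s) \<and> m (x + s) = M_alpha_plus m \<sigma> q \<tau> x s
          \<longleftrightarrow> s = 0)))"
proof -
  note H = assms(2) and T = assms(3)
  note \<sigma> = assms(4)
  have \<tau>: "\<tau> > 0" using assms(9) by simp
  have sym: "a \<bullet> (hess m x *v b) = b \<bullet> (hess m x *v a)" for a b
    unfolding assms(1) by (rule inner_hess_m3_symmetric[OF H T])
  have pos: "lc * (s \<bullet> s) \<le> s \<bullet> (hess m x *v s)" for s
    using lambda_min_le_quadratic_form[OF sym, of s] assms(6)
      mult_right_mono[OF assms(6) inner_ge_zero[of s]] by linarith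
  have psd: "0 \<le> s \<bullet> (hess m x *v s)" for s
    using pos[of s] assms(5) by (meson inner_ge_zero mult_nonneg_nonneg less_imp_le order_trans)
  have q: "1 - q / 3 > 0" using assms(8) by simp
  \<comment> \<open>The lower bound on \<tau> keeps the quadratic coefficient of the lower model
    nonnegative; the upper bound does the same in \<open>b2\<close> for its quartic
    coefficient.\<close>
  have b1: "1 / (3 * \<tau>) \<le> 1" using assms(9) by (simp add: field_simps)
  have b2: "2 * (1 - q/3) * \<tau> \<le> 1"
  proof -
    have "\<tau> < 1 / (2 * (1 - q/3))" using assms(10) by simp
    then have "\<tau> * (2 * (1 - q/3)) < 1" using q by (subst (asm) pos_less_divide_eq) auto
    then show ?thesis by (simp add: mult_ac)
  qed
  have b3: "0 \<le> 2 * (1 - q/3) * \<tau>" using q \<tau> by simp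
  have convex: "convex_on UNIV (M_alpha_plus m \<sigma> q \<tau> x)" "convex_on UNIV (M_alpha_minus m \<sigma> q \<tau> x)"
    using b1 b2 b3 \<tau> \<sigma> by (intro convex_on_M_alpha sym psd; simp)+
  have bounds: "M_alpha_minus m \<sigma> q \<tau> x s \<le> m (x + s) \<and> m (x + s) \<le> M_alpha_plus m \<sigma> q \<tau> x s \<and>
       (M_alpha_minus m \<sigma> q \<tau> x s = m (x + s) \<and> m (x + s) = M_alpha_plus m \<sigma> q \<tau> x s
          \<longleftrightarrow> s = 0)" if D: "is_region m x \<tau> (\<sigma> * q) D" and s: "s \<in> D" for D s
  proof -
    define h where "h = s \<bullet> (hess m x *v s)"
    define t where "t = tensor_app T s s \<bullet> s + 6 * \<sigma> * (x \<bullet> s) * (s \<bullet> s)"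
    \<comment> \<open>Half the difference of the upper and the lower model at \<open>s\<close>. Both
      inequalities then amount to |t| / 6 \<le> e.\<close>
    define e where "e = h / (6 * \<tau>) + (1 - q/3) * \<tau> * \<sigma> / 2 * norm s ^ 4"
    have along: "s \<bullet> (hess m (x + r *\<^sub>R s) *v s) = h + r * t + 3 * \<sigma> * r\<^sup>2 * norm s ^ 4" for r
      unfolding assms(1) h_def t_def by (rule hess_m3_along[OF H T refl])
    have "\<tau> *\<^sub>R s \<in> D" using D s by (auto simp: is_region_def)
    then have "\<sigma> * q * norm (\<tau> *\<^sub>R s) ^ 4 \<le> (\<tau> *\<^sub>R s) \<bullet> (hess m (x + \<tau> *\<^sub>R s) *v (\<tau> *\<^sub>R s))"
      "\<sigma> * q * norm (\<tau> *\<^sub>R s) ^ 4 \<le> (\<tau> *\<^sub>R s) \<bullet> (hess m (x + (- \<tau>) *\<^sub>R s) *v (\<tau> *\<^sub>R s))"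
      using D by (auto simp: is_region_def)
    \<comment> \<open>Both arguments of the quadratic form carry a factor \<tau>, hence the common
      \<tau>^2 to be cancelled; the other \<tau>^2 on the left remains from |\<tau> s|^4. The point
      x - \<tau> s is \<open>along\<close> with r = -\<tau>.\<close>
    then have "\<tau>\<^sup>2 * (\<sigma> * q * \<tau>\<^sup>2 * norm s ^ 4) \<le> \<tau>\<^sup>2 * (h + \<tau> * t + 3 * \<sigma> * \<tau>\<^sup>2 * norm s ^ 4)"
      "\<tau>\<^sup>2 * (\<sigma> * q * \<tau>\<^sup>2 * norm s ^ 4) \<le> \<tau>\<^sup>2 * (h - \<tau> * t + 3 * \<sigma> * \<tau>\<^sup>2 * norm s ^ 4)"
      using \<tau> along[of \<tau>] along[of "- \<tau>"]
      by (simp_all add: matrix_vector_mult_scaleR power_mult_distrib power2_eq_square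
          power4_eq_xxxx mult_ac)
    then have at: "\<sigma> * q * \<tau>\<^sup>2 * norm s ^ 4 \<le> h + \<tau> * t + 3 * \<sigma> * \<tau>\<^sup>2 * norm s ^ 4"
      "\<sigma> * q * \<tau>\<^sup>2 * norm s ^ 4 \<le> h - \<tau> * t + 3 * \<sigma> * \<tau>\<^sup>2 * norm s ^ 4"
      using \<tau> by simp_all
    \<comment> \<open>Here the region parameter \<sigma> q matters: it combines with 3 \<sigma> to
      (3 - q) \<sigma>, so the right side is the bound that \<open>at\<close> gives for \<tau>
      |t|.\<close>
    have "6 * \<tau> * e = h + (3 - q) * \<sigma> * \<tau>\<^sup>2 * norm s ^ 4"
      using \<tau> by (simp add: e_def field_simps power2_eq_square)
    then have "6 * \<tau> * (- t / 6) \<le> 6 * \<tau> * e" "6 * \<tau> * (t / 6) \<le> 6 * \<tau> * e"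
      using at by (simp_all add: algebra_simps)
    then have te: "- t / 6 \<le> e" "t / 6 \<le> e" using \<tau> by (simp_all only: mult_le_cancel_left_pos)
    have ms: "m (x + s) = m x + grad m x \<bullet> s + 1/2 * h + 1/6 * t + \<sigma>/4 * norm s ^ 4"
      unfolding assms(1) h_def t_def by (rule m3_taylor[OF H T refl])
    have M: "M_alpha \<epsilon> m \<sigma> q \<tau> x s = m (x + s) - t / 6 + \<epsilon> * e" for \<epsilon>
      unfolding M_alpha_def ms h_def[symmetric] e_def using \<tau> by (simp add: field_simps)
    \<comment> \<open>Equality with both models forces e = 0. Both summands of \<open>e\<close> are
      nonnegative, so h = 0, and \<open>pos\<close> bounds h below by \<open>lc\<close> times
      |s|^2.\<close>
    have "s = 0" if "e = 0"
    proof -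
      have "0 \<le> (1 - q/3) * \<tau> * \<sigma> / 2 * norm s ^ 4" using q \<tau> \<sigma> by simp
      moreover have "0 \<le> h / (6 * \<tau>)" using psd[of s] \<tau> by (simp add: h_def)
      ultimately have "h = 0" using that \<tau> unfolding e_def by (simp add: add_nonneg_eq_0_iff)
      then have "lc * (s \<bullet> s) \<le> 0" using pos[of s] by (simp add: h_def)
      then show ?thesis using assms(5) by (metis inner_gt_zero_iff linorder_not_less mult_pos_pos)
    qed
    moreover have "e = 0" "t = 0" if "s = 0"
      using that by (simp_all add: e_def h_def t_def)
    ultimately show ?thesis using te unfolding M by auto
  qed
  show ?thesis using convex bounds by blast
qed

end
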